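(* Let $X$ be a Markov chain satisfying the standing assumptions, with invariant distribution $\pi$, and let Assumption $\mathbf L(V,\varphi,\Psi)$ hold (both stated in the context). Let $D:[1,\infty)\to[1,\infty)$ be an increasing function with $\lim_{r\to\infty}D(r)=\infty$ (it may tend to infinity arbitrarily slowly), and for $q\in(0,1)$ define $$L_q(r):=r\varphi(1/r)\,\Psi\big(r/(1-q)^2\big)\,D(r),\qquad r\in[1,\infty).$$ Then for any $q\in(0,1)$ there exists a constant $c_q\in(0,1)$ such that $$\frac{c_q}{L_q(r)}\le\pi(\{V\ge r\})\qquad\text{for all } r\in[1,\infty).$$
   Context: $\mathbb N=\{0,1,\dots\}$, $\mathbb R_+=[0,\infty)$. Standing assumptions. $X=(X_n)_{n\in\mathbb N}$ is a Markov chain on a locally compact topological space $\mathcal X$ with Borel $\sigma$-algebra $\mathcal B(\mathcal X)$ and transition kernel $P$; $P^n(x,A)=\mathbb P_x(X_n\in A)$; $Pf(x)=\int f(y)P(x,\mathrm dy)$. $X$ is aperiodic, irreducible, positive Harris recurrent and Feller (for every $n$ and open $O$, $x\mapsto P^n(x,O)$ is lower semicontinuous), and ergodic with invariant distribution $\pi$, i.e. $\|P^n(x,\cdot)-\pi\|_{\mathrm{TV}}\to0$ for all $x$. Assumption $\mathbf L(V,\varphi,\Psi)$. $V:\mathcal X\to[1,\infty)$ is continuous and $\limsup_{n\to\infty}V(X_n)=\infty$ $\mathbb P_x$-a.s. for all $x$. There is $\ell_0\in[1,\infty)$ such that: (i) $\varphi:(0,1]\to\mathbb R_+$ is continuous,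 $r\mapsto r\varphi(1/r)$ is (strictly) decreasing on $[1,\infty)$, $\lim_{r\to\infty}r\varphi(1/r)=0$, and for some $b\in\mathbb R_+$: $P(1/V)-\varphi(1/V)\le 1/V+b\,\mathbf 1\{V\le\ell_0\}$ on $\mathcal X$. (ii) $\Psi:[1,\infty)\to[1,\infty)$ is differentiable, increasing and submultiplicative (for some $C\in(0,\infty)$, $\Psi(r_1+r_2)\le C\Psi(r_1)\Psi(r_2)$ for all $r_1,r_2\ge1$), and for any $\ell\in(\ell_0,\infty)$, $m\in(0,\infty)$ there is $C_{\ell,m}\in(0,1)$ with $\mathbb P_x(T^{(r)}<S_{(\ell)})\ge C_{\ell,m}/\Psi(r)$ for all $r\in(\ell+m,\infty)$ and $x\in\{V\ge\ell+m\}$, where $T^{(r)}=\inf\{n\in\mathbb N:V(X_n)>r\}$, $S_{(\ell)}=\inf\{n\in\mathbb N:V(X_n)<\ell\}$. *)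

theory Defs
  imports "HOL-Probability.Probability"
begin

text \<open>
  A time-homogeneous Markov chain: all laws \<open>Pr x\<close> (the chain started at \<open>x\<close>) live on one
  measurable space \<open>M\<close> (only \<open>space M\<close> and \<open>sets M\<close> matter), and the
  Markov property is with respect to the natural filtration.  The initial condition is stated
  through the law of \<open>X 0\<close>, since points need not be Borel sets here.
\<close>

locale markov_chain =
  fixes M :: "'w measure"
    and Pr :: "'a::topological_space \<Rightarrow> 'w measure"
    and X :: "nat \<Rightarrow> 'w \<Rightarrow> 'a"
    and P :: "'a \<Rightarrow> 'a measure"
  assumes kernel: "P \<in> borel \<rightarrow>\<^sub>M prob_algebra borel"
    and prob_space_Pr: "\<And>x. prob_space (Pr x)"
    and sets_Pr: "\<And>x. sets (Pr x) = sets M"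
    and measurable_X: "\<And>n. X n \<in> M \<rightarrow>\<^sub>M borel"
    and initial: "\<And>x. distr (Pr x) borel (X 0) = return borel x"
    and markov_property:
      "\<And>x n A. A \<in> sets borel \<Longrightarrow>
         AE \<omega> in Pr x.
           real_cond_exp (Pr x)
             (sigma (space M) {X k -` B \<inter> space M | k B. k \<le> n \<and> B \<in> sets borel})
             (indicator (X (Suc n) -` A \<inter> space M)) \<omega>
           = measure (P (X n \<omega>)) A"
begin

definition nstep :: "nat \<Rightarrow> 'a \<Rightarrow> 'a set \<Rightarrow> real" where
  "nstep n x A = measure (Pr x) {\<omega> \<in> space M. X n \<omega> \<in> A}"

definition feller :: bool where
  "feller \<longleftrightarrow> (\<forall>n U c. open U \<longrightarrow> open {x. c < nstep n x U})"

text \<open>Irreducibility, periodicity and Harris recurrence as in Meyn and Tweedie.\<close>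

definition irreducibility_measure :: "'a measure \<Rightarrow> bool" where
  "irreducibility_measure \<nu> \<longleftrightarrow>
     sets \<nu> = sets borel \<and> sigma_finite_measure \<nu> \<and> emeasure \<nu> UNIV \<noteq> 0 \<and>
     (\<forall>A\<in>sets borel. emeasure \<nu> A > 0 \<longrightarrow> (\<forall>x. \<exists>n\<ge>1. nstep n x A > 0))"

definition irreducible_chain :: bool where
  "irreducible_chain \<longleftrightarrow> (\<exists>\<nu>. irreducibility_measure \<nu>)"

definition maximal_irreducibility_measure :: "'a measure \<Rightarrow> bool" where
  "maximal_irreducibility_measure \<psi> \<longleftrightarrow>
     irreducibility_measure \<psi> \<and>
     (\<forall>\<nu>. irreducibility_measure \<nu> \<longrightarrow> absolutely_continuous \<psi> \<nu>)"

text \<open>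
  All maximal irreducibility measures have the same null sets, so the choice of \<open>\<psi>\<close>
  in the following two definitions is immaterial.
\<close>

definition cycle :: "'a measure \<Rightarrow> nat \<Rightarrow> (nat \<Rightarrow> 'a set) \<Rightarrow> bool" where
  "cycle \<psi> d D \<longleftrightarrow>
     (\<forall>i<d. D i \<in> sets borel) \<and> disjoint_family_on D {..<d} \<and>
     (\<forall>i<d. \<forall>x\<in>D i. measure (P x) (D (Suc i mod d)) = 1) \<and>
     emeasure \<psi> (UNIV - (\<Union>i<d. D i)) = 0"

definition aperiodic_chain :: bool where
  "aperiodic_chain \<longleftrightarrow>
     (\<exists>\<psi>. maximal_irreducibility_measure \<psi> \<and> \<not> (\<exists>d\<ge>2. \<exists>D. cycle \<psi> d D))"

definition harris_recurrent :: bool where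
  "harris_recurrent \<longleftrightarrow>
     (\<exists>\<psi>. maximal_irreducibility_measure \<psi> \<and>
       (\<forall>A\<in>sets borel. emeasure \<psi> A > 0 \<longrightarrow>
         (\<forall>x\<in>A. AE \<omega> in Pr x. infinite {n. X n \<omega> \<in> A})))"

definition invariant_distribution :: "'a measure \<Rightarrow> bool" where
  "invariant_distribution \<mu> \<longleftrightarrow>
     prob_space \<mu> \<and> sets \<mu> = sets borel \<and>
     (\<forall>A\<in>sets borel. measure \<mu> A = (\<integral>x. measure (P x) A \<partial>\<mu>))"

definition positive_harris_recurrent :: bool where
  "positive_harris_recurrent \<longleftrightarrow> harris_recurrent \<and> (\<exists>\<mu>. invariant_distribution \<mu>)"

text \<open>
  The supremum is the total variation distance between \<open>P\<^sup>n(x, \<cdot>)\<close> and \<open>\<mu>\<close>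
  (up to a factor 2, depending on the normalisation).
\<close>

definition ergodic_to :: "'a measure \<Rightarrow> bool" where
  "ergodic_to \<mu> \<longleftrightarrow>
     invariant_distribution \<mu> \<and>
     (\<forall>x. (\<lambda>n. SUP A\<in>sets borel. \<bar>nstep n x A - measure \<mu> A\<bar>) \<longlonglongrightarrow> 0)"

text \<open>The infimum is taken in \<open>enat\<close>, so the value is \<open>\<infinity>\<close> if \<open>A\<close> is never visited.\<close>

definition hitting_time :: "'a set \<Rightarrow> 'w \<Rightarrow> enat" where
  "hitting_time A \<omega> = Inf {enat n | n. X n \<omega> \<in> A}"

end

locale standing_assumptions = markov_chain M Pr X P
  for M :: "'w measure"
    and Pr :: "'a::topological_space \<Rightarrow> 'w measure"
    and X :: "nat \<Rightarrow> 'w \<Rightarrow> 'a"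
    and P :: "'a \<Rightarrow> 'a measure" +
  fixes \<pi> :: "'a measure"
  assumes locally_compact: "locally_compact_space (euclidean :: 'a topology)"
    and aperiodic: "aperiodic_chain"
    and irreducible: "irreducible_chain"
    and positive_harris: "positive_harris_recurrent"
    and feller: "feller"
    and ergodic: "ergodic_to \<pi>"

text \<open>
  \<open>\<phi>\<close> and \<open>\<Psi>\<close> are only relevant on \<open>(0, 1]\<close> and
  \<open>[1, \<infinity>)\<close>, respectively; all conditions on them are restricted accordingly.
\<close>

locale assumption_L = markov_chain M Pr X P
  for M :: "'w measure"
    and Pr :: "'a::topological_space \<Rightarrow> 'w measure"
    and X :: "nat \<Rightarrow> 'w \<Rightarrow> 'a"
    and P :: "'a \<Rightarrow> 'a measure" +
  fixes V :: "'a \<Rightarrow> real" and \<phi> \<Psi> :: "real \<Rightarrow> real"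
  assumes V_ge_1: "\<And>x. 1 \<le> V x"
    and V_continuous: "continuous_on UNIV V"
    and V_limsup: "\<And>x. AE \<omega> in Pr x. limsup (\<lambda>n. ereal (V (X n \<omega>))) = \<infinity>"
    and \<phi>_nonneg: "\<And>u. u \<in> {0<..1} \<Longrightarrow> 0 \<le> \<phi> u"
    and \<phi>_continuous: "continuous_on {0<..1} \<phi>"
    and \<phi>_decreasing: "strict_antimono_on {1..} (\<lambda>r. r * \<phi> (1 / r))"
    and \<phi>_limit: "((\<lambda>r. r * \<phi> (1 / r)) \<longlongrightarrow> 0) at_top"
    and \<Psi>_ge_1: "\<And>r. 1 \<le> r \<Longrightarrow> 1 \<le> \<Psi> r"
    and \<Psi>_differentiable: "\<Psi> differentiable_on {1..}"
    and \<Psi>_increasing: "mono_on {1..} \<Psi>"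
    and \<Psi>_submultiplicative:
      "\<exists>C>0. \<forall>r\<^sub>1\<ge>1. \<forall>r\<^sub>2\<ge>1. \<Psi> (r\<^sub>1 + r\<^sub>2) \<le> C * \<Psi> r\<^sub>1 * \<Psi> r\<^sub>2"
    and drift_and_excursion:
      "\<exists>l\<^sub>0\<ge>1.
         (\<exists>b\<ge>0. \<forall>x. (\<integral>y. 1 / V y \<partial>P x) - \<phi> (1 / V x)
                       \<le> 1 / V x + b * indicator {y. V y \<le> l\<^sub>0} x) \<and>
         (\<forall>l>l\<^sub>0. \<forall>m>0. \<exists>C\<in>{0<..<1}. \<forall>r>l + m. \<forall>x. V x \<ge> l + m \<longrightarrow>
            measure (Pr x) {\<omega> \<in> space M. hitting_time {y. V y > r} \<omega> < hitting_time {y. V y < l} \<omega>}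
              \<ge> C / \<Psi> r)"

definition L_rate ::
  "(real \<Rightarrow> real) \<Rightarrow> (real \<Rightarrow> real) \<Rightarrow> (real \<Rightarrow> real) \<Rightarrow> real \<Rightarrow> real \<Rightarrow> real" where
  "L_rate \<phi> \<Psi> D q r = r * \<phi> (1 / r) * \<Psi> (r / (1 - q)\<^sup>2) * D r"

end

theory Submission
  imports Defs
begin

text \<open>
  Write \<open>g r = r * \<phi> (1 / r)\<close>, \<open>A = {V \<ge> r}\<close>, \<open>B = {V < l}\<close> and
  \<open>R = r / (1 - q)\<close>.  The proof follows one excursion of the stationary chain out of \<open>B\<close>
  and counts the time that it spends in \<open>A\<close>.

  By stationarity, \<open>\<pi>(A)\<close> is the probability of being in \<open>A\<close> at a late time \<open>n\<close>.
  Decompose this event according to the last visit to \<open>B\<close>: for \<open>A\<close> disjoint from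
  \<open>B\<close> this bounds \<open>\<pi>(A)\<close> from below by the integral, over one step of the stationary
  chain out of \<open>B\<close>, of the expected time subsequently spent in \<open>A\<close> before the return to
  \<open>B\<close> (\<open>stationary_measure_ge_occupation\<close>).  Three estimates make this useful.

  \<^item> Some \<open>l > l\<^sub>0\<close> and \<open>m > 0\<close> satisfy \<open>\<pi>(V(X\<^sub>0) < l, V(X\<^sub>1) \<ge> l + m) > 0\<close>.
    Otherwise \<open>V(X\<^sub>n)\<close> could never exceed \<open>max l\<^sub>0 (V(X\<^sub>0))\<close>, against
    \<open>limsup V(X\<^sub>n) = \<infinity>\<close> (\<open>stationary_upcrossing\<close>).
  \<^item> From \<open>{V \<ge> l + m}\<close> the chain exceeds \<open>R\<close> before it returns to \<open>B\<close> with
    probability at least \<open>C / \<Psi> R\<close>, by assumption.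
  \<^item> Above \<open>r\<close>, the drift condition lets \<open>r / V(X\<^sub>n)\<close> grow by at most \<open>g r\<close>
    per step in the mean, whereas this quantity has to climb from \<open>1 - q\<close> to \<open>1\<close> before a chain
    started in \<open>{V \<ge> R}\<close> can leave \<open>A\<close>.  Hence it spends a time of order
    \<open>1 / g r\<close> in \<open>A\<close> (\<open>occupation_superlevel_ge_inverse_rate\<close>).

  Multiplied together, these give \<open>\<pi>(V \<ge> r) \<ge> const / (g r * \<Psi> (r / (1 - q)))\<close> for large
  \<open>r\<close> (\<open>stationary_superlevel_ge\<close>), which dominates \<open>const / L\<^sub>q r\<close>; small \<open>r\<close>
  cost only a smaller constant, by monotonicity.

  Occupation times and hitting probabilities are defined by recursion on the time horizon through the
  transition kernel, so that most arguments are inductions on functions of the state; the path space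
  enters only where hitting times and the limes superior are involved.
\<close>

section \<open>The transition operator and the Markov property\<close>

context markov_chain
begin

lemma kernel_subprob: "P \<in> borel \<rightarrow>\<^sub>M subprob_algebra borel"
  using kernel by (rule measurable_prob_algebraD)

lemma prob_space_P: "prob_space (P x)"
  using measurable_space[OF kernel, of x] by (simp add: space_prob_algebra)

lemma sets_P [measurable_cong, simp]: "sets (P x) = sets borel"
  using measurable_space[OF kernel, of x] by (simp add: space_prob_algebra)

lemma space_P [simp]: "space (P x) = UNIV"
  using sets_eq_imp_space_eq[OF sets_P[of x]] by simp

lemma emeasure_P_UNIV [simp]: "emeasure (P x) UNIV = 1"
  using prob_space.emeasure_space_1[OF prob_space_P[of x]] by simp

lemma sets_Pr_cong [measurable_cong]: "sets (Pr x) = sets M"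
  by (rule sets_Pr)

lemma space_Pr [simp]: "space (Pr x) = space M"
  by (rule sets_eq_imp_space_eq[OF sets_Pr])

lemma measurable_X_Pr [measurable]: "X n \<in> Pr x \<rightarrow>\<^sub>M borel"
  using measurable_X[of n] by (simp cong: measurable_cong_sets add: sets_Pr)

lemmas measurable_X_M [measurable] = measurable_X

lemma measurable_measure_P [measurable]:
  "A \<in> sets borel \<Longrightarrow> (\<lambda>x. measure (P x) A) \<in> borel_measurable borel"
  by (rule measurable_compose[OF kernel_subprob measurable_measure_subprob_algebra])

lemma nn_integral_Pr_indicator_space:
  "(\<integral>\<^sup>+\<omega>. indicator (space M) \<omega> * f \<omega> \<partial>Pr x) = (\<integral>\<^sup>+\<omega>. f \<omega> \<partial>Pr x)"
  by (intro nn_integral_cong) simp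

definition transition :: "('a \<Rightarrow> ennreal) \<Rightarrow> 'a \<Rightarrow> ennreal" where
  "transition f x = (\<integral>\<^sup>+y. f y \<partial>P x)"

lemma measurable_transition [measurable]:
  "f \<in> borel_measurable borel \<Longrightarrow> transition f \<in> borel_measurable borel"
  unfolding transition_def
  by (rule measurable_compose[OF kernel_subprob nn_integral_measurable_subprob_algebra])

lemma transition_mono: "(\<And>y. f y \<le> g y) \<Longrightarrow> transition f x \<le> transition g x"
  unfolding transition_def by (intro nn_integral_mono) auto

lemma transition_add:
  "f \<in> borel_measurable borel \<Longrightarrow> g \<in> borel_measurable borel \<Longrightarrow>
    transition (\<lambda>y. f y + g y) x = transition f x + transition g x"
  unfolding transition_def by (intro nn_integral_add) auto

lemma transition_cmult:
  "f \<in> borel_measurable borel \<Longrightarrow> transition (\<lambda>y. c * f y) x = c * transition f x"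
  unfolding transition_def by (intro nn_integral_cmult) auto

lemma transition_const [simp]: "transition (\<lambda>y. c) x = c"
  unfolding transition_def by simp

lemma transition_indicator: "A \<in> sets borel \<Longrightarrow> transition (indicator A) x = emeasure (P x) A"
  unfolding transition_def by simp

text \<open>
  Invariance is assumed on sets only, as an equation of real integrals.  It says that
  \<open>\<mu>\<close> is its own image under the kernel, hence carries over to functions.
\<close>

lemma nn_integral_stationary:
  assumes inv: "invariant_distribution \<mu>" and f: "f \<in> borel_measurable borel"
  shows "(\<integral>\<^sup>+x. transition f x \<partial>\<mu>) = (\<integral>\<^sup>+x. f x \<partial>\<mu>)"
proof -
  have sets_\<mu> [measurable_cong]: "sets \<mu> = sets borel" and prob: "prob_space \<mu>"
    using inv by (auto simp: invariant_distribution_def)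
  interpret prob_space \<mu> by (rule prob)
  have P: "P \<in> \<mu> \<rightarrow>\<^sub>M subprob_algebra borel"
    using kernel_subprob by (simp cong: measurable_cong_sets add: sets_\<mu>)
  have "\<mu> \<bind> P = \<mu>"
  proof (rule measure_eqI)
    have "space \<mu> \<noteq> {}" by (rule not_empty)
    then show "sets (\<mu> \<bind> P) = sets \<mu>"
      by (subst sets_bind[where N=borel]) (auto simp: sets_\<mu>)
    fix A assume "A \<in> sets (\<mu> \<bind> P)"
    then have A [measurable]: "A \<in> sets borel"
      using \<open>sets (\<mu> \<bind> P) = sets \<mu>\<close> sets_\<mu> by simp
    have "emeasure (\<mu> \<bind> P) A = (\<integral>\<^sup>+x. emeasure (P x) A \<partial>\<mu>)"
      by (rule emeasure_bind[OF not_empty P A])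
    also have "\<dots> = (\<integral>\<^sup>+x. ennreal (measure (P x) A) \<partial>\<mu>)"
      using prob_space_P
      by (intro nn_integral_cong finite_measure.emeasure_eq_measure)
        (simp add: prob_space.finite_measure)
    also have "\<dots> = ennreal (\<integral>x. measure (P x) A \<partial>\<mu>)"
    proof (rule nn_integral_eq_integral)
      have "(\<lambda>x. measure (P x) A) \<in> borel_measurable \<mu>"
        by measurable
      then show "integrable \<mu> (\<lambda>x. measure (P x) A)"
        using prob_space.prob_le_1[OF prob_space_P]
        by (intro integrable_const_bound[where B=1]) auto
    qed auto
    also have "\<dots> = emeasure \<mu> A"
      using inv A by (simp add: invariant_distribution_def emeasure_eq_measure)
    finally show "emeasure (\<mu> \<bind> P) A = emeasure \<mu> A" .
  qed
  then have "(\<integral>\<^sup>+x. f x \<partial>\<mu>) = (\<integral>\<^sup>+x. f x \<partial>(\<mu> \<bind> P))" by simp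
  also have "\<dots> = (\<integral>\<^sup>+x. transition f x \<partial>\<mu>)"
    unfolding transition_def by (rule nn_integral_bind[OF f P])
  finally show ?thesis by simp
qed

definition history :: "nat \<Rightarrow> 'w measure" where
  "history n = sigma (space M) {X k -` B \<inter> space M | k B. k \<le> n \<and> B \<in> sets borel}"

lemma history_generator:
  "{X k -` B \<inter> space M | k B. k \<le> n \<and> B \<in> sets borel} \<subseteq> Pow (space M)"
  by auto

lemma space_history [simp]: "space (history n) = space M"
  unfolding history_def using history_generator by (simp add: space_measure_of)

lemma sets_history_subset: "sets (history n) \<subseteq> sets M"
proof -
  have "{X k -` B \<inter> space M | k B. k \<le> n \<and> B \<in> sets borel} \<subseteq> sets M"
    using measurable_X by (auto intro: measurable_sets)
  then show ?thesis
    unfolding history_def sets_measure_of[OF history_generator]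
    by (rule sets.sigma_sets_subset)
qed

lemma measurable_X_history: "k \<le> n \<Longrightarrow> X k \<in> history n \<rightarrow>\<^sub>M borel"
proof (rule measurableI)
  fix B :: "'a set" assume "k \<le> n" "B \<in> sets borel"
  then show "X k -` B \<inter> space (history n) \<in> sets (history n)"
    unfolding space_history
    unfolding history_def sets_measure_of[OF history_generator]
    by (intro sigma_sets.Basic) auto
qed auto

text \<open>
  A form of the Markov property without conditional expectations.  Both sides are integrals of \<open>f\<close>, with respect to the law of \<open>X (Suc n)\<close> restricted to \<open>F\<close> and the image under \<open>P\<close> of the law of
  \<open>X n\<close> restricted to \<open>F\<close>; these measures agree by the defining property of
  conditional expectation.
\<close>

lemma markov_step:
  assumes f: "f \<in> borel_measurable borel" and F: "F \<in> sets (history n)"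
  shows "(\<integral>\<^sup>+\<omega>. indicator F \<omega> * f (X (Suc n) \<omega>) \<partial>Pr x)
    = (\<integral>\<^sup>+\<omega>. indicator F \<omega> * transition f (X n \<omega>) \<partial>Pr x)"
proof -
  interpret prob_space "Pr x" by (rule prob_space_Pr)
  have FM [measurable]: "F \<in> sets M" using F sets_history_subset by blast
  note [measurable] = f
  interpret finite_measure_subalgebra "Pr x" "history n"
    using sets_history_subset by unfold_locales (auto simp: subalgebra_def sets_Pr)
  define \<mu> where "\<mu> k = distr (density (Pr x) (indicator F)) borel (X k)" for k
  have sets_\<mu> [measurable_cong]: "sets (\<mu> k) = sets borel" for k by (simp add: \<mu>_def)
  have space_\<mu>: "space (\<mu> k) = UNIV" for k by (simp add: \<mu>_def)
  have nn_\<mu>: "(\<integral>\<^sup>+z. g z \<partial>\<mu> k) = (\<integral>\<^sup>+\<omega>. indicator F \<omega> * g (X k \<omega>) \<partial>Pr x)"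
    if [measurable]: "g \<in> borel_measurable borel" for g k
    unfolding \<mu>_def by (simp add: nn_integral_distr nn_integral_density)
  have P: "P \<in> \<mu> n \<rightarrow>\<^sub>M subprob_algebra borel"
    using kernel_subprob by (simp cong: measurable_cong_sets add: sets_\<mu>)
  have "\<mu> (Suc n) = \<mu> n \<bind> P"
  proof (rule measure_eqI)
    show "sets (\<mu> (Suc n)) = sets (\<mu> n \<bind> P)"
      by (subst sets_bind[where N=borel]) (auto simp: sets_\<mu> space_\<mu>)
    fix A assume "A \<in> sets (\<mu> (Suc n))"
    then have A [measurable]: "A \<in> sets borel" by (simp add: sets_\<mu>)
    have bound: "integrable (Pr x) g"
      if "g \<in> borel_measurable (Pr x)" "\<And>\<omega>. 0 \<le> g \<omega>" "\<And>\<omega>. g \<omega> \<le> 1" for g :: "'w \<Rightarrow> real"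
      using that by (intro integrable_const_bound[where B=1]) auto
    define S where "S = X (Suc n) -` A \<inter> space M"
    have S [measurable]: "S \<in> sets M" unfolding S_def using measurable_X A by (rule measurable_sets)
    have le1: "measure (P z) A \<le> 1" for z by (rule prob_space.prob_le_1[OF prob_space_P])
    have "(\<integral>\<omega>\<in>F. indicator S \<omega> \<partial>Pr x) =
        (\<integral>\<omega>\<in>F. real_cond_exp (Pr x) (history n) (indicator S) \<omega> \<partial>Pr x)"
      by (rule real_cond_exp_intA[OF _ F]) (intro bound, auto split: split_indicator)
    also have "\<dots> = (\<integral>\<omega>\<in>F. measure (P (X n \<omega>)) A \<partial>Pr x)"
      unfolding set_lebesgue_integral_def
    proof (rule integral_cong_AE)
      show "AE \<omega> in Pr x. indicat_real F \<omega> *\<^sub>R real_cond_exp (Pr x) (history n) (indicator S) \<omega> =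
          indicat_real F \<omega> *\<^sub>R measure (P (X n \<omega>)) A"
        using markov_property[OF A, of x n, folded history_def S_def] by eventually_elim simp
    qed measurable
    finally have eq: "(\<integral>\<omega>. indicator F \<omega> * indicator S \<omega> \<partial>Pr x)
        = (\<integral>\<omega>. indicator F \<omega> * measure (P (X n \<omega>)) A \<partial>Pr x)"
      by (simp add: set_lebesgue_integral_def)
    have "emeasure (\<mu> (Suc n)) A = (\<integral>\<^sup>+z. indicator A z \<partial>\<mu> (Suc n))"
      by (simp add: sets_\<mu>)
    also have "\<dots> = (\<integral>\<^sup>+\<omega>. indicator F \<omega> * indicator A (X (Suc n) \<omega>) \<partial>Pr x)"
      by (rule nn_\<mu>) simp
    also have "\<dots> = (\<integral>\<^sup>+\<omega>. ennreal (indicator F \<omega> * indicator S \<omega>) \<partial>Pr x)"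
      by (intro nn_integral_cong) (auto simp: S_def split: split_indicator)
    also have "\<dots> = ennreal (\<integral>\<omega>. indicator F \<omega> * indicator S \<omega> \<partial>Pr x)"
      by (intro nn_integral_eq_integral bound) (auto split: split_indicator)
    also have "\<dots> = (\<integral>\<^sup>+\<omega>. ennreal (indicator F \<omega> * measure (P (X n \<omega>)) A) \<partial>Pr x)"
      unfolding eq by (intro nn_integral_eq_integral[symmetric] bound)
        (auto split: split_indicator simp: le1)
    also have "\<dots> = (\<integral>\<^sup>+\<omega>. indicator F \<omega> * emeasure (P (X n \<omega>)) A \<partial>Pr x)"
      using prob_space_P
      by (intro nn_integral_cong) (auto split: split_indicator
          simp: finite_measure.emeasure_eq_measure prob_space.finite_measure)
    also have "\<dots> = (\<integral>\<^sup>+z. emeasure (P z) A \<partial>\<mu> n)"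
      by (rule nn_\<mu>[symmetric]) (use kernel_subprob A in \<open>rule measurable_emeasure_kernel\<close>)
    also have "\<dots> = emeasure (\<mu> n \<bind> P) A"
      by (rule emeasure_bind[symmetric, OF _ P A]) (simp add: space_\<mu>)
    finally show "emeasure (\<mu> (Suc n)) A = emeasure (\<mu> n \<bind> P) A" .
  qed
  then have "(\<integral>\<^sup>+z. f z \<partial>\<mu> (Suc n)) = (\<integral>\<^sup>+z. transition f z \<partial>\<mu> n)"
    unfolding transition_def using nn_integral_bind[OF f P] by simp
  then show ?thesis by (simp add: nn_\<mu>)
qed

lemma nn_integral_X_0:
  assumes [measurable]: "f \<in> borel_measurable borel"
  shows "(\<integral>\<^sup>+\<omega>. f (X 0 \<omega>) \<partial>Pr x) = f x"
proof -
  have "(\<integral>\<^sup>+\<omega>. f (X 0 \<omega>) \<partial>Pr x) = (\<integral>\<^sup>+y. f y \<partial>distr (Pr x) borel (X 0))"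
    by (simp add: nn_integral_distr)
  then show ?thesis by (simp add: initial nn_integral_return)
qed

lemma measurable_transition_power [measurable]:
  "f \<in> borel_measurable borel \<Longrightarrow> (transition ^^ n) f \<in> borel_measurable borel"
  by (induction n) auto

lemma nn_integral_X:
  assumes "f \<in> borel_measurable borel"
  shows "(\<integral>\<^sup>+\<omega>. f (X n \<omega>) \<partial>Pr x) = (transition ^^ n) f x"
  using assms
proof (induction n arbitrary: f)
  case 0
  then show ?case by (simp add: nn_integral_X_0)
next
  case (Suc n)
  have "space M \<in> sets (history n)" using sets.top[of "history n"] by simp
  from markov_step[OF Suc.prems this, of x]
  have "(\<integral>\<^sup>+\<omega>. f (X (Suc n) \<omega>) \<partial>Pr x) = (\<integral>\<^sup>+\<omega>. transition f (X n \<omega>) \<partial>Pr x)"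
    by (simp add: nn_integral_Pr_indicator_space)
  also have "\<dots> = (transition ^^ n) (transition f) x"
    using Suc.prems by (intro Suc.IH) measurable
  finally show ?case by (simp add: funpow_swap1)
qed

lemma nn_integral_stationary_power:
  assumes "invariant_distribution \<mu>" "f \<in> borel_measurable borel"
  shows "(\<integral>\<^sup>+x. (transition ^^ n) f x \<partial>\<mu>) = (\<integral>\<^sup>+x. f x \<partial>\<mu>)"
  using assms by (induction n) (simp_all add: nn_integral_stationary)

section \<open>Occupation times and the last-exit bound\<close>

text \<open>
  The expected number of visits to \<open>A\<close> during the times \<open>0, \<dots>, n - 1\<close> and strictly
  before the first visit to \<open>B\<close>.  Nothing is counted when the chain starts in \<open>B\<close>.
\<close>

primrec occupation :: "'a set \<Rightarrow> 'a set \<Rightarrow> nat \<Rightarrow> 'a \<Rightarrow> ennreal" where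
  "occupation A B 0 = (\<lambda>x. 0)"
| "occupation A B (Suc n) =
     (\<lambda>x. indicator (- B) x * (indicator A x + transition (occupation A B n) x))"

lemma measurable_occupation [measurable]:
  assumes [measurable]: "A \<in> sets borel" "B \<in> sets borel"
  shows "occupation A B n \<in> borel_measurable borel"
  by (induction n) simp_all

lemma occupation_le: "occupation A B n x \<le> of_nat n"
proof (induction n arbitrary: x)
  case (Suc n)
  have "transition (occupation A B n) x \<le> transition (\<lambda>y. of_nat n) x"
    by (intro transition_mono Suc)
  then have "indicator A x + transition (occupation A B n) x \<le> 1 + of_nat n"
    by (intro add_mono) (auto split: split_indicator)
  then show ?case by (auto split: split_indicator)
qed simp

lemma occupation_Suc_mono: "occupation A B n x \<le> occupation A B (Suc n) x"
proof (induction n arbitrary: x)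
  case (Suc n)
  have "transition (occupation A B n) x \<le> transition (occupation A B (Suc n)) x"
    by (intro transition_mono Suc)
  then show ?case
    unfolding occupation.simps(2)[of A B n] occupation.simps(2)[of A B "Suc n"]
    by (intro mult_left_mono add_left_mono) auto
qed simp

lemma occupation_mono: "m \<le> n \<Longrightarrow> occupation A B m x \<le> occupation A B n x"
  by (rule lift_Suc_mono_le[of "\<lambda>n. occupation A B n x"]) (rule occupation_Suc_mono)

lemma occupation_antimono:
  assumes "B \<subseteq> B'"
  shows "occupation A B' n x \<le> occupation A B n x"
proof (induction n arbitrary: x)
  case (Suc n)
  have "transition (occupation A B' n) x \<le> transition (occupation A B n) x"
    by (intro transition_mono Suc)
  then show ?case using assms
    by (auto intro!: mult_mono add_left_mono split: split_indicator)
qed simp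

text \<open>
  The last-exit bound.  In operator form it is a one-line computation: with \<open>G\<^sub>n\<close> the
  occupation function, \<open>G\<^sub>n\<^sub>+\<^sub>1 + 1\<^sub>B PG\<^sub>n = 1\<^sub>A + PG\<^sub>n\<close>.
  Integrate against \<open>\<mu>\<close>, replace \<open>\<mu>(PG\<^sub>n)\<close> by \<open>\<mu>(G\<^sub>n)\<close>, and
  use that \<open>G\<^sub>n\<close> increases with \<open>n\<close>.
\<close>

lemma stationary_measure_ge_occupation:
  assumes inv: "invariant_distribution \<mu>"
    and A [measurable]: "A \<in> sets borel" and B [measurable]: "B \<in> sets borel"
    and disj: "A \<inter> B = {}"
  shows "(\<integral>\<^sup>+x. indicator B x * transition (occupation A B n) x \<partial>\<mu>) \<le> emeasure \<mu> A"
proof -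
  have sets_\<mu> [measurable_cong]: "sets \<mu> = sets borel" and prob: "prob_space \<mu>"
    using inv by (auto simp: invariant_distribution_def)
  interpret prob_space \<mu> by (rule prob)
  let ?G = "occupation A B"
  \<comment> \<open>Finiteness allows \<open>\<mu>(G\<^sub>n)\<close> to be cancelled at the end.\<close>
  have fin: "(\<integral>\<^sup>+x. ?G n x \<partial>\<mu>) \<noteq> \<infinity>"
  proof -
    have "(\<integral>\<^sup>+x. ?G n x \<partial>\<mu>) \<le> (\<integral>\<^sup>+x. of_nat n \<partial>\<mu>)"
      by (intro nn_integral_mono occupation_le)
    also have "\<dots> = of_nat n" by (simp add: emeasure_space_1)
    finally show ?thesis
      using ennreal_of_nat_neq_top[of n] by (auto simp: top_unique)
  qed
  have split: "?G (Suc n) x + indicator B x * transition (?G n) x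
      = indicator A x + transition (?G n) x" for x
    using disj by (auto split: split_indicator)
  have "(\<integral>\<^sup>+x. ?G n x \<partial>\<mu>) + (\<integral>\<^sup>+x. indicator B x * transition (?G n) x \<partial>\<mu>)
      \<le> (\<integral>\<^sup>+x. ?G (Suc n) x \<partial>\<mu>) + (\<integral>\<^sup>+x. indicator B x * transition (?G n) x \<partial>\<mu>)"
    by (intro add_right_mono nn_integral_mono occupation_Suc_mono)
  also have "\<dots> = (\<integral>\<^sup>+x. ?G (Suc n) x + indicator B x * transition (?G n) x \<partial>\<mu>)"
    by (intro nn_integral_add[symmetric]) measurable
  also have "\<dots> = (\<integral>\<^sup>+x. indicator A x + transition (?G n) x \<partial>\<mu>)"
    by (simp only: split)
  also have "\<dots> = (\<integral>\<^sup>+x. indicator A x \<partial>\<mu>) + (\<integral>\<^sup>+x. transition (?G n) x \<partial>\<mu>)"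
    by (intro nn_integral_add) measurable
  also have "\<dots> = (\<integral>\<^sup>+x. ?G n x \<partial>\<mu>) + emeasure \<mu> A"
    by (simp add: nn_integral_stationary[OF inv] sets_\<mu> add.commute)
  finally show ?thesis
    using fin by (simp add: ennreal_add_left_cancel_le)
qed

section \<open>Reaching a set before another one\<close>

text \<open>
  The probability that \<open>E\<close> is visited before time \<open>n\<close> and before \<open>B\<close>
  (for disjoint \<open>E\<close> and \<open>B\<close>, see \<open>reach_eq\<close>).
\<close>

primrec reach :: "'a set \<Rightarrow> 'a set \<Rightarrow> nat \<Rightarrow> 'a \<Rightarrow> ennreal" where
  "reach E B 0 = (\<lambda>x. 0)"
| "reach E B (Suc n) = (\<lambda>x. indicator E x + indicator (- (E \<union> B)) x * transition (reach E B n) x)"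

lemma measurable_reach [measurable]:
  assumes [measurable]: "E \<in> sets borel" "B \<in> sets borel"
  shows "reach E B n \<in> borel_measurable borel"
  by (induction n) simp_all

lemma reach_Suc_mono: "reach E B n x \<le> reach E B (Suc n) x"
proof (induction n arbitrary: x)
  case (Suc n)
  have "transition (reach E B n) x \<le> transition (reach E B (Suc n)) x"
    by (intro transition_mono Suc)
  then show ?case
    unfolding reach.simps(2)[of E B n] reach.simps(2)[of E B "Suc n"]
    by (intro mult_left_mono add_left_mono) auto
qed simp

lemma incseq_reach: "incseq (\<lambda>n. reach E B n x)"
  by (rule incseq_SucI) (rule reach_Suc_mono)

text \<open>
  The process that equals \<open>reach E B (n - k) (X k)\<close> while \<open>E \<union> B\<close> has not been
  visited, and is frozen at \<open>1\<close> or \<open>0\<close> afterwards, is a martingale.  Its mean is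
  \<open>reach E B n x\<close> at \<open>k = 0\<close> and the hitting probability at \<open>k = n\<close>.
\<close>

lemma reach_eq:
  assumes E [measurable]: "E \<in> sets borel" and B [measurable]: "B \<in> sets borel"
    and disj: "E \<inter> B = {}"
  shows "reach E B n x
    = emeasure (Pr x) {\<omega>\<in>space M. \<exists>j<n. X j \<omega> \<in> E \<and> (\<forall>i\<le>j. X i \<omega> \<notin> B)}"
proof -
  define hit where "hit k = {\<omega>\<in>space M. \<exists>j<k. X j \<omega> \<in> E \<and> (\<forall>i\<le>j. X i \<omega> \<notin> B)}" for k
  define alive where "alive k = {\<omega>\<in>space M. \<forall>j<k. X j \<omega> \<notin> E \<union> B}" for k
  have hit_M [measurable]: "hit k \<in> sets M" for k unfolding hit_def by measurable
  have alive_M [measurable]: "alive k \<in> sets M" for k unfolding alive_def by measurable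
  have alive_history: "alive (Suc k) \<in> sets (history k)" for k
  proof -
    have "{\<omega>\<in>space (history k). X j \<omega> \<notin> E \<union> B} \<in> sets (history k)" if "j \<le> k" for j
    proof -
      have [measurable]: "X j \<in> history k \<rightarrow>\<^sub>M borel" using that by (rule measurable_X_history)
      show ?thesis by measurable
    qed
    then have "(\<Inter>j\<in>{..k}. {\<omega>\<in>space (history k). X j \<omega> \<notin> E \<union> B}) \<in> sets (history k)"
      by (intro sets.finite_INT) auto
    also have "(\<Inter>j\<in>{..k}. {\<omega>\<in>space (history k). X j \<omega> \<notin> E \<union> B}) = alive (Suc k)"
      by (auto simp: alive_def less_Suc_eq_le)
    finally show ?thesis .
  qed
  \<comment> \<open>The martingale property, with \<open>m = n - k\<close> the remaining time.\<close>
  have "emeasure (Pr x) (hit k) + (\<integral>\<^sup>+\<omega>. indicator (alive k) \<omega> * reach E B m (X k \<omega>) \<partial>Pr x)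
      = reach E B (k + m) x" for k m
  proof (induction k arbitrary: m)
    case 0
    have "hit 0 = {}" "alive 0 = space M" by (auto simp: hit_def alive_def)
    then show ?case
      using nn_integral_X_0[of "reach E B m" x] by (simp add: nn_integral_Pr_indicator_space)
  next
    case (Suc k)
    let ?R = "reach E B"
    define new where "new = {\<omega>\<in>alive k. X k \<omega> \<in> E}"
    have [measurable]: "new \<in> sets M"
    proof -
      have "new = alive k \<inter> (X k -` E \<inter> space M)" by (auto simp: new_def alive_def)
      then show ?thesis using measurable_sets[OF measurable_X[of k] E] by auto
    qed
    have hit_Suc: "hit (Suc k) = hit k \<union> new"
    proof (intro set_eqI iffI)
      fix \<omega> assume h: "\<omega> \<in> hit (Suc k)"
      show "\<omega> \<in> hit k \<union> new"
      proof (cases "\<omega> \<in> hit k")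
        case False
        then show ?thesis
          using h by (auto simp: hit_def new_def alive_def less_Suc_eq)
      qed simp
    next
      fix \<omega> assume "\<omega> \<in> hit k \<union> new"
      then show "\<omega> \<in> hit (Suc k)"
        using disj by (auto simp: hit_def new_def alive_def less_Suc_eq le_less)
    qed
    have disj_new: "hit k \<inter> new = {}" by (auto simp: hit_def new_def alive_def)
    have split: "indicator (alive k) \<omega> * ?R (Suc m) (X k \<omega>)
      = indicator new \<omega> + indicator (alive (Suc k)) \<omega> * transition (?R m) (X k \<omega>)" for \<omega>
      by (auto simp: new_def alive_def less_Suc_eq split: split_indicator)
    have "?R (Suc k + m) x = ?R (k + Suc m) x" by simp
    also have "\<dots> = emeasure (Pr x) (hit k)
        + (\<integral>\<^sup>+\<omega>. indicator (alive k) \<omega> * ?R (Suc m) (X k \<omega>) \<partial>Pr x)"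
      by (rule Suc.IH[symmetric])
    also have "\<dots> = emeasure (Pr x) (hit k) + (emeasure (Pr x) new
        + (\<integral>\<^sup>+\<omega>. indicator (alive (Suc k)) \<omega> * transition (?R m) (X k \<omega>) \<partial>Pr x))"
      unfolding split by (subst nn_integral_add) (auto simp: sets_Pr)
    also have "\<dots> = emeasure (Pr x) (hit (Suc k))
        + (\<integral>\<^sup>+\<omega>. indicator (alive (Suc k)) \<omega> * transition (?R m) (X k \<omega>) \<partial>Pr x)"
      unfolding hit_Suc using disj_new
      by (subst plus_emeasure[symmetric]) (auto simp: sets_Pr add.assoc)
    also have "(\<integral>\<^sup>+\<omega>. indicator (alive (Suc k)) \<omega> * transition (?R m) (X k \<omega>) \<partial>Pr x)
        = (\<integral>\<^sup>+\<omega>. indicator (alive (Suc k)) \<omega> * ?R m (X (Suc k) \<omega>) \<partial>Pr x)"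
      by (rule markov_step[symmetric, OF _ alive_history]) measurable
    finally show ?case by simp
  qed
  from this[of n 0] show ?thesis by (simp add: hit_def)
qed

lemma hitting_time_less_iff:
  assumes disj: "E \<inter> B = {}"
  shows "hitting_time E \<omega> < hitting_time B \<omega> \<longleftrightarrow> (\<exists>j. X j \<omega> \<in> E \<and> (\<forall>i\<le>j. X i \<omega> \<notin> B))"
proof
  assume "hitting_time E \<omega> < hitting_time B \<omega>"
  then obtain a where "a \<in> {enat n | n. X n \<omega> \<in> E}" "a < hitting_time B \<omega>"
    unfolding hitting_time_def[of E] Inf_less_iff by blast
  then obtain j where j: "X j \<omega> \<in> E" "enat j < hitting_time B \<omega>" by auto
  have "X i \<omega> \<notin> B" if "i \<le> j" for i
  proof
    assume "X i \<omega> \<in> B"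
    then have "hitting_time B \<omega> \<le> enat i"
      unfolding hitting_time_def by (intro Inf_lower) auto
    with that j(2) show False
      by (metis enat_ord_simps(1) leD order_trans)
  qed
  with j show "\<exists>j. X j \<omega> \<in> E \<and> (\<forall>i\<le>j. X i \<omega> \<notin> B)" by auto
next
  assume "\<exists>j. X j \<omega> \<in> E \<and> (\<forall>i\<le>j. X i \<omega> \<notin> B)"
  then obtain j where j: "X j \<omega> \<in> E" "\<forall>i\<le>j. X i \<omega> \<notin> B" by auto
  have "hitting_time E \<omega> \<le> enat j"
    unfolding hitting_time_def using j by (intro Inf_lower) auto
  moreover have "enat (Suc j) \<le> hitting_time B \<omega>"
    unfolding hitting_time_def
  proof (rule Inf_greatest)
    fix a assume "a \<in> {enat n | n. X n \<omega> \<in> B}"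
    then obtain n where "a = enat n" "X n \<omega> \<in> B" by auto
    then show "enat (Suc j) \<le> a" using j(2) by (auto simp: not_less_eq_eq[symmetric])
  qed
  ultimately show "hitting_time E \<omega> < hitting_time B \<omega>"
    by (metis enat_ord_simps(2) lessI less_le_trans order_le_less_trans)
qed

lemma SUP_reach:
  assumes E [measurable]: "E \<in> sets borel" and B [measurable]: "B \<in> sets borel"
    and disj: "E \<inter> B = {}"
  shows "(SUP n. reach E B n x)
    = emeasure (Pr x) {\<omega>\<in>space M. hitting_time E \<omega> < hitting_time B \<omega>}"
proof -
  define hit where "hit k = {\<omega>\<in>space M. \<exists>j<k. X j \<omega> \<in> E \<and> (\<forall>i\<le>j. X i \<omega> \<notin> B)}" for k :: nat
  have [measurable]: "hit k \<in> sets M" for k unfolding hit_def by measurable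
  have "incseq hit" unfolding hit_def by (intro incseq_SucI) (auto intro: less_SucI)
  then have "(SUP n. emeasure (Pr x) (hit n)) = emeasure (Pr x) (\<Union>n. hit n)"
    by (intro SUP_emeasure_incseq) (auto simp: sets_Pr)
  moreover have "(\<Union>n. hit n) = {\<omega>\<in>space M. hitting_time E \<omega> < hitting_time B \<omega>}"
    by (auto simp: hit_def hitting_time_less_iff[OF disj])
  ultimately show ?thesis by (simp add: reach_eq[OF E B disj] hit_def)
qed

text \<open>
  Strong Markov property at the first visit to \<open>E\<close>, as an induction on the horizon: whoever reaches
  \<open>E\<close> within \<open>n\<close> steps has \<open>N\<close> further steps to collect \<open>\<delta>\<close>.
\<close>

lemma occupation_ge_reach:
  assumes E [measurable]: "E \<in> sets borel" and B [measurable]: "B \<in> sets borel"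
    and A [measurable]: "A \<in> sets borel" and disj: "E \<inter> B = {}"
    and stay: "\<And>x. x \<in> E \<Longrightarrow> \<delta> \<le> occupation A B N x"
  shows "\<delta> * reach E B n x \<le> occupation A B (n + N) x"
proof (induction n arbitrary: x)
  case (Suc n)
  have "\<delta> * transition (reach E B n) x = transition (\<lambda>y. \<delta> * reach E B n y) x"
    by (intro transition_cmult[symmetric]) measurable
  also have "\<dots> \<le> transition (occupation A B (n + N)) x"
    by (intro transition_mono Suc)
  finally have step: "\<delta> * transition (reach E B n) x \<le> transition (occupation A B (n + N)) x" .
  consider "x \<in> E" | "x \<in> B" "x \<notin> E" | "x \<notin> E" "x \<notin> B" by blast
  then show ?case
  proof cases
    case 1
    then have "\<delta> \<le> occupation A B (Suc n + N) x"
      using stay occupation_mono[of N "Suc n + N" A B x] by (meson le_add2 order_trans)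
    then show ?thesis using 1 by simp
  next
    case 3
    then show ?thesis using step by (simp add: add_increasing)
  qed simp
qed simp

end

section \<open>Time spent above a level\<close>

context assumption_L
begin

lemma measurable_V [measurable]: "V \<in> borel_measurable borel"
  using V_continuous by (rule borel_measurable_continuous_onI)

lemma V_pos: "0 < V x"
  using V_ge_1[of x] by simp

lemma rate_antimono: "1 \<le> r \<Longrightarrow> r \<le> s \<Longrightarrow> s * \<phi> (1 / s) \<le> r * \<phi> (1 / r)"
  using \<phi>_decreasing unfolding monotone_on_def by (cases "r = s") (auto simp: less_le)

lemma rate_pos: "1 \<le> r \<Longrightarrow> 0 < r * \<phi> (1 / r)"
proof -
  assume r: "1 \<le> r"
  have "0 \<le> (r + 1) * \<phi> (1 / (r + 1))"
    using r by (intro mult_nonneg_nonneg \<phi>_nonneg) auto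
  also have "\<dots> < r * \<phi> (1 / r)"
    using \<phi>_decreasing r unfolding monotone_on_def by auto
  finally show ?thesis .
qed

text \<open>
  Above \<open>l\<^sub>0\<close> the indicator in the drift condition vanishes, and
  \<open>r * \<phi> (1 / v) \<le> v * \<phi> (1 / v) \<le> r * \<phi> (1 / r)\<close> for \<open>v = V x \<ge> r\<close>.
\<close>

lemma transition_inverse_V_le:
  assumes drift: "\<And>x. (\<integral>y. 1 / V y \<partial>P x) - \<phi> (1 / V x)
      \<le> 1 / V x + b * indicator {y. V y \<le> l\<^sub>0} x"
    and r: "1 \<le> r" "l\<^sub>0 < r" and x: "r \<le> V x"
  shows "transition (\<lambda>y. ennreal (r / V y)) x \<le> ennreal (r / V x + r * \<phi> (1 / r))"
proof -
  have "integrable (P x) (\<lambda>y. r / V y)"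
  proof (rule finite_measure.integrable_const_bound[where B=r])
    show "finite_measure (P x)" using prob_space_P by (rule prob_space.finite_measure)
    have "norm (r / V y) \<le> r" for y
    proof -
      have "r * 1 \<le> r * V y" using r V_ge_1[of y] by (intro mult_left_mono) auto
      then show ?thesis using r V_pos[of y] by (simp add: divide_simps)
    qed
    then show "AE y in P x. norm (r / V y) \<le> r" by simp
  qed simp
  then have "transition (\<lambda>y. ennreal (r / V y)) x = ennreal (\<integral>y. r / V y \<partial>P x)"
    unfolding transition_def using r V_pos
    by (intro nn_integral_eq_integral) (auto simp: less_imp_le)
  also have "(\<integral>y. r / V y \<partial>P x) = r * (\<integral>y. 1 / V y \<partial>P x)"
    by (subst integral_mult_right_zero[symmetric]) simp
  also have "\<dots> \<le> r * (1 / V x + \<phi> (1 / V x))"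
    using drift[of x] r x by (intro mult_left_mono) auto
  also have "\<dots> \<le> r / V x + r * \<phi> (1 / r)"
  proof -
    have nonneg: "0 \<le> \<phi> (1 / V x)" using V_ge_1[of x] by (intro \<phi>_nonneg) auto
    have "r * \<phi> (1 / V x) \<le> V x * \<phi> (1 / V x)"
      using x nonneg by (rule mult_right_mono)
    also have "\<dots> \<le> r * \<phi> (1 / r)" using r x by (intro rate_antimono) auto
    finally show ?thesis by (simp add: distrib_left)
  qed
  finally show ?thesis by (simp add: ennreal_leI)
qed

text \<open>
  Let \<open>\<tau>\<close> be the exit time from \<open>{V \<ge> r}\<close> and \<open>g = r * \<phi> (1 / r)\<close>.  Since
  \<open>r / V\<close> exceeds \<open>1\<close> at time \<open>\<tau>\<close> and drifts upwards by at most \<open>g\<close> per step before,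
  Markov's inequality gives \<open>P(\<tau> \<le> k) \<le> r / V x + k * g\<close>.  Summing
  \<open>P(\<tau> > k)\<close> over \<open>k < n\<close>, with \<open>k\<close> estimated by \<open>n\<close>, yields the bound; the induction
  on \<open>n\<close> checks it directly.  The correction stands on the right, as subtraction truncates at
  zero for extended nonnegative reals.
\<close>

lemma occupation_superlevel_ge:
  assumes drift: "\<And>x. (\<integral>y. 1 / V y \<partial>P x) - \<phi> (1 / V x)
      \<le> 1 / V x + b * indicator {y. V y \<le> l\<^sub>0} x"
    and r: "1 \<le> r" "l\<^sub>0 < r"
  shows "ennreal (real n) \<le> occupation {y. r \<le> V y} {y. V y < r} n x
    + ennreal (real n * (r / V x) + r * \<phi> (1 / r) * (real n)\<^sup>2)"
proof (induction n arbitrary: x)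
  case (Suc n)
  let ?O = "occupation {y. r \<le> V y} {y. V y < r}"
  define g where "g = r * \<phi> (1 / r)"
  have g: "0 < g" unfolding g_def using r by (intro rate_pos)
  have w: "0 \<le> r / V y" for y using r V_pos[of y] by simp
  show ?case
  proof (cases "r \<le> V x")
    case True
    have "ennreal (real n) = transition (\<lambda>y. ennreal (real n)) x" by simp
    also have "\<dots> \<le> transition (\<lambda>y. ?O n y + ennreal (real n * (r / V y) + g * (real n)\<^sup>2)) x"
      using Suc.IH by (intro transition_mono) (simp add: g_def)
    also have "\<dots> = transition (\<lambda>y. ?O n y + (ennreal (real n) * ennreal (r / V y)
        + ennreal (g * (real n)\<^sup>2))) x"
    proof -
      have "ennreal (real n * (r / V y) + g * (real n)\<^sup>2)
          = ennreal (real n) * ennreal (r / V y) + ennreal (g * (real n)\<^sup>2)" for y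
      proof -
        have "0 \<le> real n * (r / V y)" "0 \<le> g * (real n)\<^sup>2"
          using w[of y] g by (intro mult_nonneg_nonneg; simp)+
        then show ?thesis using w[of y] by (simp only: ennreal_plus ennreal_mult of_nat_0_le_iff)
      qed
      then show ?thesis by simp
    qed
    also have "\<dots> = transition (?O n) x + (ennreal (real n) * transition (\<lambda>y. ennreal (r / V y)) x
        + ennreal (g * (real n)\<^sup>2))"
      by (simp add: transition_add transition_cmult)
    also have "\<dots> \<le> transition (?O n) x + (ennreal (real n) * ennreal (r / V x + g)
        + ennreal (g * (real n)\<^sup>2))"
      unfolding g_def using transition_inverse_V_le[OF drift r True]
      by (intro add_left_mono add_right_mono mult_left_mono) auto
    also have "\<dots> = transition (?O n) x + ennreal (real n * (r / V x + g) + g * (real n)\<^sup>2)"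
      using w[of x] g by (simp add: ennreal_mult[symmetric] ennreal_plus[symmetric] del: ennreal_plus)
    also have "\<dots> \<le> transition (?O n) x
        + ennreal (real (Suc n) * (r / V x) + g * (real (Suc n))\<^sup>2)"
    proof (intro add_left_mono ennreal_leI)
      have "g * real n + g * (real n)\<^sup>2 \<le> g * (real (Suc n))\<^sup>2"
        using g by (simp add: power2_eq_square algebra_simps)
      moreover have "real n * (r / V x + g) = real n * (r / V x) + g * real n"
        by (simp add: distrib_left mult.commute)
      moreover have "real n * (r / V x) \<le> real (Suc n) * (r / V x)"
        using w[of x] by (intro mult_right_mono) auto
      ultimately show "real n * (r / V x + g) + g * (real n)\<^sup>2
          \<le> real (Suc n) * (r / V x) + g * (real (Suc n))\<^sup>2" by linarith
    qed
    finally have "1 + ennreal (real n) \<le> 1 + (transition (?O n) x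
        + ennreal (real (Suc n) * (r / V x) + g * (real (Suc n))\<^sup>2))"
      by (rule add_left_mono)
    moreover have "1 + ennreal (real n) = ennreal (real (Suc n))"
      by simp
    moreover have "?O (Suc n) x = 1 + transition (?O n) x" using True by simp
    ultimately show ?thesis unfolding g_def[symmetric] by (simp only: add.assoc)
  next
    case False
    then have "1 \<le> r / V x" using V_pos[of x] by simp
    then have "real (Suc n) * 1 \<le> real (Suc n) * (r / V x)"
      by (intro mult_left_mono) auto
    then have "real (Suc n) \<le> real (Suc n) * (r / V x) + g * (real (Suc n))\<^sup>2"
      using g by (simp add: add_increasing2)
    then have "ennreal (real (Suc n)) \<le> ennreal (real (Suc n) * (r / V x) + g * (real (Suc n))\<^sup>2)"
      by (rule ennreal_leI)
    then show ?thesis unfolding g_def[symmetric] by (rule add_increasing[OF zero_le])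
  qed
qed simp

text \<open>
  For \<open>V x \<ge> r / (1 - q)\<close> the preceding bound reads \<open>n * q - g * n\<^sup>2\<close>, which is at least
  \<open>n * q / 2\<close> up to the horizon \<open>n = q / (2 * g)\<close>, and rounding this horizon down
  loses at most one half of it when \<open>g \<le> q / 4\<close>.
\<close>

lemma occupation_superlevel_ge_inverse_rate:
  assumes drift: "\<And>x. (\<integral>y. 1 / V y \<partial>P x) - \<phi> (1 / V x)
      \<le> 1 / V x + b * indicator {y. V y \<le> l\<^sub>0} x"
    and r: "1 \<le> r" "l\<^sub>0 < r" and q: "0 < q" "q < 1" and small: "r * \<phi> (1 / r) \<le> q / 4"
  obtains N where "\<And>x. r / (1 - q) \<le> V x \<Longrightarrow>
    ennreal (q\<^sup>2 / (8 * (r * \<phi> (1 / r)))) \<le> occupation {y. r \<le> V y} {y. V y < r} N x"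
proof -
  define g where "g = r * \<phi> (1 / r)"
  have g: "0 < g" unfolding g_def using r by (intro rate_pos)
  define N where "N = nat \<lfloor>q / (2 * g)\<rfloor>"
  have ge1: "1 \<le> q / (4 * g)" using small g q by (simp add: g_def field_simps)
  have N_le: "real N \<le> q / (2 * g)" unfolding N_def using g q by simp
  have "q / (2 * g) - 1 \<le> real N" unfolding N_def by linarith
  moreover have "q / (2 * g) = q / (4 * g) + q / (4 * g)" using g by (simp add: field_simps)
  ultimately have N_ge: "q / (4 * g) \<le> real N" using ge1 by linarith
  show ?thesis
  proof (rule that[of N])
    fix x assume x: "r / (1 - q) \<le> V x"
    have w: "r / V x \<le> 1 - q" using x q V_pos[of x] by (simp add: field_simps)
    have w0: "0 \<le> r / V x" using r V_pos[of x] by simp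
    have "g * real N \<le> q / 2" using N_le g by (simp add: field_simps)
    then have gN: "g * (real N)\<^sup>2 \<le> q / 2 * real N"
      using mult_right_mono[of "g * real N" "q / 2" "real N"]
      by (simp add: power2_eq_square algebra_simps)
    have wN: "real N * (r / V x) \<le> real N * (1 - q)" using w by (intro mult_left_mono) auto
    have "q\<^sup>2 / (8 * g) = q / 2 * (q / (4 * g))" by (simp add: power2_eq_square)
    also have "\<dots> \<le> q / 2 * real N" using N_ge q by (intro mult_left_mono) auto
    also have "\<dots> \<le> real N - (real N * (r / V x) + g * (real N)\<^sup>2)"
      using gN wN by (simp add: algebra_simps)
    finally have "ennreal (q\<^sup>2 / (8 * g))
        \<le> ennreal (real N - (real N * (r / V x) + g * (real N)\<^sup>2))"
      by (rule ennreal_leI)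
    also have "\<dots> = ennreal (real N) - ennreal (real N * (r / V x) + g * (real N)\<^sup>2)"
      using mult_nonneg_nonneg[of "real N", OF _ w0] g
      by (intro ennreal_minus[symmetric] add_nonneg_nonneg) auto
    also have "\<dots> \<le> occupation {y. r \<le> V y} {y. V y < r} N x"
      using occupation_superlevel_ge[OF drift r, of N x]
      by (intro ennreal_minus_le_iff[THEN iffD2]) (auto simp: g_def add.commute)
    finally show "ennreal (q\<^sup>2 / (8 * (r * \<phi> (1 / r)))) \<le> occupation {y. r \<le> V y} {y. V y < r} N x"
      by (simp add: g_def)
  qed
qed

section \<open>Upward jumps under the invariant distribution\<close>

text \<open>
  Suppose that the stationary chain almost surely makes no jump from below \<open>l\<close> to above
  \<open>l + m\<close>, for all rational \<open>l > l\<^sub>0\<close> and \<open>m > 0\<close>.  Then \<open>V(X\<^sub>n)\<close> never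
  exceeds \<open>max l\<^sub>0 (V(X\<^sub>0))\<close>, which contradicts the assumption on the limes superior.
  As \<open>x \<mapsto> Pr x\<close> may fail to be measurable, there is no path measure of the stationary
  chain; instead, one fixes a single starting point \<open>x\<close> that is typical for all times and all
  rational \<open>l\<close> and \<open>m\<close> at once.
\<close>

lemma stationary_upcrossing:
  assumes inv: "invariant_distribution \<mu>"
  obtains l m where "l\<^sub>0 < l" "0 < m"
    "0 < (\<integral>\<^sup>+x. indicator {y. V y < l} x * emeasure (P x) {y. l + m \<le> V y} \<partial>\<mu>)"
proof (rule ccontr)
  assume no: "\<not> thesis"
  define e where "e l m x = indicator {y. V y < l} x * emeasure (P x) {y. l + m \<le> V y}" for l m x
  have e_eq: "e l m = (\<lambda>x. indicator {y. V y < l} x * transition (indicator {y. l + m \<le> V y}) x)" for l m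
  proof (rule ext)
    show "e l m x = indicator {y. V y < l} x * transition (indicator {y. l + m \<le> V y}) x" for x
      unfolding e_def by (subst transition_indicator) simp_all
  qed
  have [measurable]: "e l m \<in> borel_measurable borel" for l m
    by (simp add: e_eq)
  have sets_\<mu> [measurable_cong]: "sets \<mu> = sets borel" and prob: "prob_space \<mu>"
    using inv by (auto simp: invariant_distribution_def)
  interpret \<mu>: prob_space \<mu> by (rule prob)
  define I where "I = {(l, m). l \<in> \<rat> \<and> m \<in> \<rat> \<and> l\<^sub>0 < l \<and> (0::real) < m}"
  have countable_I: "countable I"
    by (rule countable_subset[of _ "\<rat> \<times> \<rat>"]) (auto simp: I_def countable_rat)
  have "AE x in \<mu>. \<forall>(l, m)\<in>I. \<forall>n. (transition ^^ n) (e l m) x = 0"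
    unfolding case_prod_beta AE_ball_countable[OF countable_I] AE_all_countable
  proof (intro ballI allI)
    fix p n assume "p \<in> I"
    then have lm: "l\<^sub>0 < fst p" "0 < snd p" by (auto simp: I_def)
    have "(\<integral>\<^sup>+x. (transition ^^ n) (e (fst p) (snd p)) x \<partial>\<mu>) = (\<integral>\<^sup>+x. e (fst p) (snd p) x \<partial>\<mu>)"
      by (rule nn_integral_stationary_power[OF inv]) measurable
    also have "\<dots> = 0"
    proof (rule ccontr)
      assume "\<not> ?thesis"
      then have "0 < (\<integral>\<^sup>+x. e (fst p) (snd p) x \<partial>\<mu>)" by (simp only: not_gr_zero[symmetric] not_not)
      then have thesis unfolding e_def by (rule that[OF lm])
      with no show False by (rule notE)
    qed
    finally show "AE x in \<mu>. (transition ^^ n) (e (fst p) (snd p)) x = 0"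
      by (subst (asm) nn_integral_0_iff_AE) auto
  qed
  then obtain x where "\<forall>(l, m)\<in>I. \<forall>n. (transition ^^ n) (e l m) x = 0"
    by (blast dest: eventually_happens'[OF \<mu>.ae_filter_bot])
  then have x: "(transition ^^ n) (e l m) x = 0" if "(l, m) \<in> I" for l m n
    using that by auto
  interpret prob_space "Pr x" by (rule prob_space_Pr)
  have "AE \<omega> in Pr x. \<forall>(l, m)\<in>I. \<forall>n. \<not> (V (X n \<omega>) < l \<and> l + m \<le> V (X (Suc n) \<omega>))"
    unfolding case_prod_beta AE_ball_countable[OF countable_I] AE_all_countable
  proof (intro ballI allI)
    fix p n assume p: "p \<in> I"
    define l m where "l = fst p" and "m = snd p"
    define F where "F = {\<omega>\<in>space (history n). V (X n \<omega>) < l}"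
    have [measurable]: "X n \<in> history n \<rightarrow>\<^sub>M borel" by (rule measurable_X_history) simp
    have F: "F \<in> sets (history n)" unfolding F_def by measurable
    then have [measurable]: "F \<in> sets M" using sets_history_subset by blast
    have "(\<integral>\<^sup>+\<omega>. indicator F \<omega> * indicator {y. l + m \<le> V y} (X (Suc n) \<omega>) \<partial>Pr x)
        = (\<integral>\<^sup>+\<omega>. indicator F \<omega> * transition (indicator {y. l + m \<le> V y}) (X n \<omega>) \<partial>Pr x)"
      by (rule markov_step[OF _ F]) measurable
    also have "\<dots> = (\<integral>\<^sup>+\<omega>. e l m (X n \<omega>) \<partial>Pr x)"
      by (intro nn_integral_cong) (auto simp: e_eq F_def split: split_indicator)
    also have "\<dots> = (transition ^^ n) (e l m) x" by (rule nn_integral_X) measurable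
    also have "\<dots> = 0" using p by (intro x) (simp add: l_def m_def)
    finally have "AE \<omega> in Pr x. indicator F \<omega> * indicator {y. l + m \<le> V y} (X (Suc n) \<omega>) = (0::ennreal)"
      by (subst (asm) nn_integral_0_iff_AE) auto
    then show "AE \<omega> in Pr x. \<not> (V (X n \<omega>) < fst p \<and> fst p + snd p \<le> V (X (Suc n) \<omega>))"
      using AE_space by eventually_elim (auto simp: F_def l_def m_def)
  qed
  moreover have "AE \<omega> in Pr x. limsup (\<lambda>n. ereal (V (X n \<omega>))) = \<infinity>" by (rule V_limsup)
  ultimately have "AE \<omega> in Pr x. False"
  proof eventually_elim
    fix \<omega> assume lim: "limsup (\<lambda>n. ereal (V (X n \<omega>))) = \<infinity>"
      and nojump: "\<forall>(l, m)\<in>I. \<forall>n. \<not> (V (X n \<omega>) < l \<and> l + m \<le> V (X (Suc n) \<omega>))"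
    have step: "V (X (Suc n) \<omega>) \<le> max l\<^sub>0 (V (X n \<omega>))" for n
    proof (rule ccontr)
      assume "\<not> ?thesis"
      \<comment> \<open>An increase above \<open>l\<^sub>0\<close> leaves room for rational \<open>l\<close> and \<open>m\<close>.\<close>
      then obtain l where l: "l \<in> \<rat>" "max l\<^sub>0 (V (X n \<omega>)) < l" "l < V (X (Suc n) \<omega>)"
        using Rats_dense_in_real[of "max l\<^sub>0 (V (X n \<omega>))" "V (X (Suc n) \<omega>)"] by (auto simp: not_le)
      then obtain m where "m \<in> \<rat>" "0 < m" "m < V (X (Suc n) \<omega>) - l"
        using Rats_dense_in_real[of 0 "V (X (Suc n) \<omega>) - l"] by auto
      with l have "(l, m) \<in> I" "V (X n \<omega>) < l" "l + m \<le> V (X (Suc n) \<omega>)"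
        by (auto simp: I_def)
      with nojump show False by blast
    qed
    define c where "c = max l\<^sub>0 (V (X 0 \<omega>))"
    have "V (X n \<omega>) \<le> c" for n
    proof (induction n)
      case (Suc n)
      then show ?case using step[of n] by (simp add: c_def)
    qed (simp add: c_def)
    then have "limsup (\<lambda>n. ereal (V (X n \<omega>))) \<le> ereal c"
      by (intro Limsup_bounded always_eventually allI) simp
    with lim show False by simp
  qed
  then show False by simp
qed

section \<open>Lower bounds for the tail of the invariant distribution\<close>

text \<open>
  One excursion, in three factors: the jump out of \<open>{V < l}\<close>, the climb above
  \<open>r / (1 - q)\<close>, and the time then spent above \<open>r\<close>.
\<close>

lemma stationary_superlevel_ge:
  assumes inv: "invariant_distribution \<mu>"
    and drift: "\<And>x. (\<integral>y. 1 / V y \<partial>P x) - \<phi> (1 / V x)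
      \<le> 1 / V x + b * indicator {y. V y \<le> l\<^sub>0} x"
    and excursion: "\<And>r x. r > l + m \<Longrightarrow> V x \<ge> l + m \<Longrightarrow>
      measure (Pr x) {\<omega> \<in> space M. hitting_time {y. V y > r} \<omega> < hitting_time {y. V y < l} \<omega>}
        \<ge> C / \<Psi> r"
    and C: "0 \<le> C" and l: "l\<^sub>0 < l" and m: "0 < m"
    and r: "1 \<le> r" "l + m < r" and q: "0 < q" "q < 1" and small: "r * \<phi> (1 / r) \<le> q / 4"
  shows "ennreal (q\<^sup>2 / (8 * (r * \<phi> (1 / r)))) * ennreal (C / \<Psi> (r / (1 - q)))
      * (\<integral>\<^sup>+x. indicator {y. V y < l} x * emeasure (P x) {y. l + m \<le> V y} \<partial>\<mu>)
    \<le> emeasure \<mu> {y. r \<le> V y}"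
proof -
  let ?A = "{y. r \<le> V y}" and ?B = "{y. V y < l}" and ?K = "{y. l + m \<le> V y}"
  define R where "R = r / (1 - q)"
  let ?E = "{y. R < V y}"
  have rR: "r \<le> R" unfolding R_def using r q by (simp add: field_simps)
  define \<delta> where "\<delta> = ennreal (q\<^sup>2 / (8 * (r * \<phi> (1 / r))))"
  have sets_\<mu> [measurable_cong]: "sets \<mu> = sets borel"
    using inv by (auto simp: invariant_distribution_def)
  have disj: "?E \<inter> ?B = {}" "?A \<inter> ?B = {}" using rR r m by auto
  have l0r: "l\<^sub>0 < r" using l m r by simp
  obtain N where N: "\<And>x. R \<le> V x \<Longrightarrow> \<delta> \<le> occupation ?A {y. V y < r} N x"
    using occupation_superlevel_ge_inverse_rate[OF drift r(1) l0r q small]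
    unfolding R_def \<delta>_def by blast
  have stay: "\<delta> \<le> occupation ?A ?B N x" if "x \<in> ?E" for x
  proof -
    have "\<delta> \<le> occupation ?A {y. V y < r} N x" using that by (intro N) simp
    also have "\<dots> \<le> occupation ?A ?B N x" using r m by (intro occupation_antimono) auto
    finally show ?thesis .
  qed
  define Q where "Q n x = \<delta> * reach ?E ?B n x" for n x
  have [measurable]: "Q n \<in> borel_measurable borel" for n unfolding Q_def by measurable
  have Q_mono: "Q n x \<le> Q n' x" if "n \<le> n'" for n n' x
    unfolding Q_def using incseqD[OF incseq_reach that] by (intro mult_left_mono) auto
  have K: "\<delta> * ennreal (C / \<Psi> R) * indicator ?K x \<le> (SUP n. Q n x)" for x
  proof (cases "x \<in> ?K")
    case True
    have fin: "finite_measure (Pr x)" using prob_space_Pr by (rule prob_space.finite_measure)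
    have "ennreal (C / \<Psi> R) \<le> emeasure (Pr x)
        {\<omega> \<in> space M. hitting_time ?E \<omega> < hitting_time ?B \<omega>}"
      unfolding finite_measure.emeasure_eq_measure[OF fin]
      using excursion[of R x] True rR r by (intro ennreal_leI) auto
    also have "\<dots> = (SUP n. reach ?E ?B n x)"
      by (rule SUP_reach[symmetric]) (use disj in auto)
    finally have "\<delta> * ennreal (C / \<Psi> R) \<le> \<delta> * (SUP n. reach ?E ?B n x)"
      by (rule mult_left_mono) simp
    then show ?thesis using True by (simp add: Q_def SUP_mult_left_ennreal)
  qed simp
  have "\<delta> * ennreal (C / \<Psi> R) * (\<integral>\<^sup>+x. indicator ?B x * emeasure (P x) ?K \<partial>\<mu>)
      = (\<integral>\<^sup>+x. indicator ?B x * transition (\<lambda>y. \<delta> * ennreal (C / \<Psi> R) * indicator ?K y) x \<partial>\<mu>)"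
    by (subst nn_integral_cmult[symmetric])
      (auto simp: transition_cmult transition_indicator[symmetric] mult_ac)
  also have "\<dots> \<le> (\<integral>\<^sup>+x. indicator ?B x * transition (\<lambda>y. SUP n. Q n y) x \<partial>\<mu>)"
    by (intro nn_integral_mono mult_left_mono transition_mono K) auto
  also have "\<dots> = (\<integral>\<^sup>+x. (SUP n. indicator ?B x * transition (Q n) x) \<partial>\<mu>)"
  proof (intro nn_integral_cong)
    fix x
    have "transition (\<lambda>y. SUP n. Q n y) x = (SUP n. transition (Q n) x)"
      unfolding transition_def
      by (rule nn_integral_monotone_convergence_SUP) (auto simp: incseq_def le_fun_def Q_mono)
    then show "indicator ?B x * transition (\<lambda>y. SUP n. Q n y) x
        = (SUP n. indicator ?B x * transition (Q n) x)"
      by (simp add: SUP_mult_left_ennreal)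
  qed
  also have "\<dots> = (SUP n. \<integral>\<^sup>+x. indicator ?B x * transition (Q n) x \<partial>\<mu>)"
    by (rule nn_integral_monotone_convergence_SUP)
      (auto simp: incseq_def le_fun_def intro!: mult_left_mono transition_mono Q_mono)
  also have "\<dots> \<le> emeasure \<mu> ?A"
  proof (rule SUP_least)
    fix n
    have "(\<integral>\<^sup>+x. indicator ?B x * transition (Q n) x \<partial>\<mu>)
        \<le> (\<integral>\<^sup>+x. indicator ?B x * transition (occupation ?A ?B (n + N)) x \<partial>\<mu>)"
      unfolding Q_def using disj
      by (intro nn_integral_mono mult_left_mono transition_mono occupation_ge_reach stay) auto
    also have "\<dots> \<le> emeasure \<mu> ?A"
      by (rule stationary_measure_ge_occupation[OF inv]) (use disj in auto)
    finally show "(\<integral>\<^sup>+x. indicator ?B x * transition (Q n) x \<partial>\<mu>) \<le> emeasure \<mu> ?A" .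
  qed
  finally show ?thesis by (simp add: \<delta>_def R_def)
qed

end

theorem theorem2p3:
  fixes M :: "'w measure"
    and Pr :: "'a::topological_space \<Rightarrow> 'w measure"
    and X :: "nat \<Rightarrow> 'w \<Rightarrow> 'a"
    and P :: "'a \<Rightarrow> 'a measure"
    and \<pi> :: "'a measure"
    and V :: "'a \<Rightarrow> real"
    and \<phi> \<Psi> D :: "real \<Rightarrow> real"
  assumes "standing_assumptions M Pr X P \<pi>"
    and "assumption_L M Pr X P V \<phi> \<Psi>"
    and "\<And>r. 1 \<le> r \<Longrightarrow> 1 \<le> D r"
    and "mono_on {1..} D"
    and "filterlim D at_top at_top"
  shows "\<forall>q\<in>{0<..<1}. \<exists>c\<in>{0<..<1}. \<forall>r\<ge>1.
           c / L_rate \<phi> \<Psi> D q r \<le> measure \<pi> {x. V x \<ge> r}"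
proof
  fix q :: real assume "q \<in> {0<..<1}"
  then have q: "0 < q" "q < 1" by auto
  interpret assumption_L M Pr X P V \<phi> \<Psi> by fact
  interpret S: standing_assumptions M Pr X P \<pi> by fact
  have inv: "invariant_distribution \<pi>" using S.ergodic by (simp add: ergodic_to_def)
  then have sets_\<pi> [measurable_cong]: "sets \<pi> = sets borel" and prob: "prob_space \<pi>"
    by (auto simp: invariant_distribution_def)
  interpret \<pi>: prob_space \<pi> by (rule prob)
  define g where "g r = r * \<phi> (1 / r)" for r
  have g_pos: "0 < g r" if "1 \<le> r" for r unfolding g_def using that by (rule rate_pos)
  obtain l\<^sub>0 b where l0: "1 \<le> l\<^sub>0" and drift: "\<And>x. (\<integral>y. 1 / V y \<partial>P x) - \<phi> (1 / V x)
        \<le> 1 / V x + b * indicator {y. V y \<le> l\<^sub>0} x"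
    and exc: "\<forall>l>l\<^sub>0. \<forall>m>0. \<exists>C\<in>{0<..<1}. \<forall>r>l + m. \<forall>x. V x \<ge> l + m \<longrightarrow>
      measure (Pr x) {\<omega> \<in> space M. hitting_time {y. V y > r} \<omega> < hitting_time {y. V y < l} \<omega>}
        \<ge> C / \<Psi> r"
    using drift_and_excursion by blast
  define \<kappa> where "\<kappa> l m = (\<integral>\<^sup>+x. indicator {y. V y < l} x * emeasure (P x) {y. l + m \<le> V y} \<partial>\<pi>)" for l m
  obtain l m where lm: "l\<^sub>0 < l" "0 < m" and \<kappa>_pos: "0 < \<kappa> l m"
    unfolding \<kappa>_def by (rule stationary_upcrossing[OF inv, of l\<^sub>0])
  obtain C where C: "0 < C" "C < 1" and excursion: "\<And>r x. r > l + m \<Longrightarrow> V x \<ge> l + m \<Longrightarrow>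
      measure (Pr x) {\<omega> \<in> space M. hitting_time {y. V y > r} \<omega> < hitting_time {y. V y < l} \<omega>}
        \<ge> C / \<Psi> r"
    using exc[rule_format, OF lm] by auto
  have "\<kappa> l m \<le> (\<integral>\<^sup>+x. 1 \<partial>\<pi>)"
    unfolding \<kappa>_def using prob_space.emeasure_le_1[OF prob_space_P]
    by (intro nn_integral_mono) (auto split: split_indicator)
  then have "\<kappa> l m \<le> 1" by (simp add: \<pi>.emeasure_space_1)
  then obtain k where k: "\<kappa> l m = ennreal k" "0 < k" "k \<le> 1"
    using \<kappa>_pos by (cases "\<kappa> l m") (auto simp: top_unique)
  have "\<forall>\<^sub>F r in at_top. g r < q / 4"
    unfolding g_def using \<phi>_limit q by (intro order_tendstoD(2)) auto
  then obtain r1 where r1: "\<And>r. r1 \<le> r \<Longrightarrow> g r < q / 4" by (auto simp: eventually_at_top_linorder)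
  \<comment> \<open>The excursion bound applies above \<open>r0\<close>.\<close>
  define r0 where "r0 = max (max r1 (l + m + 1)) 1"
  define a where "a = q\<^sup>2 / 8 * C * k"
  have a_pos: "0 < a" unfolding a_def using q C k by simp
  have a_less: "a < 1"
  proof -
    have "q\<^sup>2 \<le> 1" using q by (simp add: power_le_one)
    then have "q\<^sup>2 / 8 * C * k \<le> 1 / 8 * 1 * 1" using q C k by (intro mult_mono) auto
    then show ?thesis by (simp add: a_def)
  qed
  have large: "a / (g r * \<Psi> (r / (1 - q))) \<le> measure \<pi> {x. r \<le> V x}" if r: "r0 \<le> r" for r
  proof -
    have r': "1 \<le> r" "l + m < r" "g r \<le> q / 4" using r r1[of r] by (auto simp: r0_def)
    have \<Psi>1: "1 \<le> \<Psi> (r / (1 - q))" using r' q by (intro \<Psi>_ge_1) (simp add: field_simps)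
    have "ennreal (q\<^sup>2 / (8 * g r)) * ennreal (C / \<Psi> (r / (1 - q))) * ennreal k
        \<le> emeasure \<pi> {y. r \<le> V y}"
      using stationary_superlevel_ge[OF inv drift excursion _ lm r'(1,2) q] r'(3) C k(1)
      by (simp add: g_def \<kappa>_def)
    also have "ennreal (q\<^sup>2 / (8 * g r)) * ennreal (C / \<Psi> (r / (1 - q))) * ennreal k
        = ennreal (a / (g r * \<Psi> (r / (1 - q))))"
      using \<Psi>1 g_pos[OF r'(1)] C k by (simp add: ennreal_mult[symmetric] a_def)
    finally show ?thesis by (simp add: \<pi>.emeasure_eq_measure)
  qed
  have r0: "1 \<le> r0" by (simp add: r0_def)
  have L_ge: "g r * \<Psi> (r / (1 - q)) \<le> L_rate \<phi> \<Psi> D q r" and g_le_L: "g r \<le> L_rate \<phi> \<Psi> D q r"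
    and g\<Psi>_pos: "0 < g r * \<Psi> (r / (1 - q))"
    if r: "1 \<le> r" for r
  proof -
    have q2: "(1 - q)\<^sup>2 \<le> 1 - q" using q by (simp add: power2_eq_square mult_left_le)
    have le: "1 \<le> r / (1 - q)" using r q by (simp add: field_simps)
    have le2: "r / (1 - q) \<le> r / (1 - q)\<^sup>2" using r q q2 by (intro divide_left_mono) auto
    have mono: "\<Psi> (r / (1 - q)) \<le> \<Psi> (r / (1 - q)\<^sup>2)"
      using le le2 by (intro mono_onD[OF \<Psi>_increasing]) auto
    have \<Psi>1: "1 \<le> \<Psi> (r / (1 - q))" using le by (rule \<Psi>_ge_1)
    have "g r * \<Psi> (r / (1 - q)) * 1 \<le> g r * \<Psi> (r / (1 - q)\<^sup>2) * D r"
      using mono \<Psi>1 g_pos[OF r] assms(3)[OF r] by (intro mult_mono) auto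
    then show 1: "g r * \<Psi> (r / (1 - q)) \<le> L_rate \<phi> \<Psi> D q r"
      by (simp add: L_rate_def g_def)
    have "g r * 1 \<le> g r * \<Psi> (r / (1 - q))" using \<Psi>1 g_pos[OF r] by (intro mult_left_mono) auto
    with 1 show "g r \<le> L_rate \<phi> \<Psi> D q r" by simp
    show "0 < g r * \<Psi> (r / (1 - q))" using g_pos[OF r] \<Psi>1 by simp
  qed
  define p where "p = measure \<pi> {x. r0 \<le> V x}"
  have p_pos: "0 < p"
  proof -
    have "0 < a / (g r0 * \<Psi> (r0 / (1 - q)))" using a_pos g\<Psi>_pos[OF r0] by simp
    also have "\<dots> \<le> p" unfolding p_def by (rule large) simp
    finally show ?thesis .
  qed
  \<comment> \<open>The second term handles \<open>r < r0\<close>: there \<open>L\<^sub>q r \<ge> g r \<ge> g r0\<close> and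
    \<open>\<pi>(V \<ge> r) \<ge> \<pi>(V \<ge> r0)\<close>.\<close>
  define c where "c = min a (p * g r0)"
  have c: "0 < c" "c < 1" using a_pos a_less p_pos g_pos[OF r0] by (auto simp: c_def)
  have "c / L_rate \<phi> \<Psi> D q r \<le> measure \<pi> {x. V x \<ge> r}" if r: "1 \<le> r" for r
  proof (cases "r0 \<le> r")
    case True
    have "c / L_rate \<phi> \<Psi> D q r \<le> a / (g r * \<Psi> (r / (1 - q)))"
      using L_ge[OF r] g\<Psi>_pos[OF r] a_pos c by (intro frac_le) (auto simp: c_def)
    also have "\<dots> \<le> measure \<pi> {x. V x \<ge> r}" using True by (rule large)
    finally show ?thesis .
  next
    case False
    have "g r0 \<le> g r" unfolding g_def using False r by (intro rate_antimono) auto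
    then have "c / L_rate \<phi> \<Psi> D q r \<le> p * g r0 / g r0"
      using g_le_L[OF r] g_pos[OF r0] p_pos c by (intro frac_le) (auto simp: c_def)
    also have "\<dots> = p" using g_pos[OF r0] by simp
    also have "\<dots> \<le> measure \<pi> {x. V x \<ge> r}"
      unfolding p_def using False by (intro \<pi>.finite_measure_mono) auto
    finally show ?thesis .
  qed
  with c show "\<exists>c\<in>{0<..<1}. \<forall>r\<ge>1. c / L_rate \<phi> \<Psi> D q r \<le> measure \<pi> {x. V x \<ge> r}"
    by (intro bexI[of _ c] allI impI) auto
qed

end
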